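(* Assume that $0<\lambda<n$. There is a constant $c>0$ such that the inequality $$\|Mf\|_{\mathcal{M}_{L(1+\log^+L),\lambda}}\le c\,\|f\|_{\mathcal{M}_{L(1+\log^+L),\lambda}}$$ holds for all $f\in\mathfrak{M}^{\mathrm{rad},\downarrow}$, with $c$ independent of $f$.
   Context: Cubes in $\mathbb{R}^n$ have sides parallel to the coordinate axes; $\log^+t=\max\{\log t,0\}$. $M$ is the Hardy-Littlewood maximal operator $Mf(x)=\sup_{Q\ni x}\frac1{|Q|}\int_Q|f(y)|\,dy$ (supremum over all cubes containing $x$). $\mathfrak{M}^{\mathrm{rad},\downarrow}=\mathfrak{M}^{\mathrm{rad},\downarrow}(\mathbb{R}^n)$ is the set of measurable, radially decreasing functions on $\mathbb{R}^n$, i.e. measurable $f$ of the form $f(x)=\varphi(|x|)$ with $\varphi$ measurable and non-increasing on $(0,\infty)$. For a cube $Q$ and measurable $g$, $\|g\|_{L(1+\log^+L),Q}:=\inf\{\alpha>0:\frac1{|Q|}\int_Q\frac{|g(x)|}{\alpha}\left(1+\log^+\frac{|g(x)|}{\alpha}\right)dx\le1\}$. For measurable $f$ on $\mathbb{R}^n$ the Zygmund-Morrey norm is $\|f\|_{\mathcal{M}_{L(1+\log^+L),\lambda}}:=\sup_Q|Q|^{\lambda/n}\|f\|_{L(1+\log^+L),Q}$ (supremum over all cubes), with value $\infty$ allowed; $\mathcal{M}_{L(1+\log^+L),\lambda}$ (also written $\mathcal M_{L(\log L),\lambda}$) is the set of $f$ for which it is finite. *)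

theory Defs
  imports "HOL-Analysis.Analysis"
begin

text \<open>
  Measurable functions take values in \<^typ>\<open>ereal\<close>: the maximal function of a function in the
  spaces below may be infinite at a point (e.g. that of \<open>\<bar>x\<bar> powr (-\<lambda>)\<close> at the origin), and in this
  way a single norm applies to \<open>f\<close> and to \<open>M f\<close>. Integrals of nonnegative quantities, averages and
  norms are in \<^typ>\<open>ennreal\<close>. Measurable means Lebesgue measurable.
\<close>

definition cubes :: "'a::euclidean_space set set" where
  "cubes = {cbox a (a + s *\<^sub>R One) | a s. 0 < s}"

definition average :: "'a::euclidean_space set \<Rightarrow> ('a \<Rightarrow> ennreal) \<Rightarrow> ennreal" where
  "average Q h = (\<integral>\<^sup>+x\<in>Q. h x \<partial>lebesgue) / emeasure lebesgue Q"

definition abs_val :: "ereal \<Rightarrow> ennreal" where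
  "abs_val y = e2ennreal \<bar>y\<bar>"

definition hl_maximal :: "('a::euclidean_space \<Rightarrow> ereal) \<Rightarrow> 'a \<Rightarrow> ereal" where
  "hl_maximal f x = enn2ereal (SUP Q \<in> {Q \<in> cubes. x \<in> Q}. average Q (\<lambda>y. abs_val (f y)))"

text \<open>At 0 the definition relies on \<open>ln 0 = 0\<close> in HOL, which gives the right value \<open>log\<^sup>+ 0 = 0\<close>.\<close>

definition log_plus :: "ennreal \<Rightarrow> ennreal" where
  "log_plus t = (if t = \<infinity> then \<infinity> else ennreal (max (ln (enn2real t)) 0))"

text \<open>The infimum is \<open>\<infinity>\<close> if no real \<open>\<alpha>\<close> is admissible.\<close>

definition zygmund_norm :: "'a::euclidean_space set \<Rightarrow> ('a \<Rightarrow> ereal) \<Rightarrow> ennreal" where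
  "zygmund_norm Q g = (INF \<alpha> \<in> {\<alpha>::real. 0 < \<alpha> \<and>
      average Q (\<lambda>x. abs_val (g x) / ennreal \<alpha> * (1 + log_plus (abs_val (g x) / ennreal \<alpha>))) \<le> 1}.
    ennreal \<alpha>)"

definition zygmund_morrey_norm :: "real \<Rightarrow> ('a::euclidean_space \<Rightarrow> ereal) \<Rightarrow> ennreal" where
  "zygmund_morrey_norm l f =
    (SUP Q \<in> cubes. ennreal (measure lebesgue Q powr (l / real DIM('a))) * zygmund_norm Q f)"

text \<open>The profile \<open>\<phi>\<close> is constrained on \<open>(0,\<infinity>)\<close> only, so \<open>f 0 = \<phi> 0\<close> is arbitrary. No sign condition
  is imposed on \<open>f\<close>.\<close>

definition rad_decreasing :: "('a::euclidean_space \<Rightarrow> ereal) set" where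
  "rad_decreasing = {f \<in> borel_measurable lebesgue.
    \<exists>\<phi>. \<phi> \<in> borel_measurable (lebesgue_on {0<..}) \<and> antimono_on {0<..} \<phi> \<and> (\<forall>x. f x = \<phi> (norm x))}"

end

theory Submission
  imports Defs
begin

text \<open>
  The proof compares everything with the single function \<open>\<bar>x\<bar>\<^sup>-\<^sup>\<lambda>\<close>, where \<open>0 < \<lambda> < n\<close>. If \<open>f\<close> is
  nonnegative and radially decreasing, then \<open>f(x)\<close> is a lower bound of \<open>f\<close> on a cube of side
  \<open>\<bar>x\<bar>/n\<close> with a corner at the origin, and a lower bound of \<open>f\<close> on a cube \<open>Q\<close> is a lower bound of
  its Zygmund norm on \<open>Q\<close>. Hence \<open>f(x) \<le> n\<^sup>\<lambda> N \<bar>x\<bar>\<^sup>-\<^sup>\<lambda>\<close> for \<open>x \<noteq> 0\<close>, where \<open>N\<close> is the Zygmund-Morrey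
  norm of \<open>f\<close> (\<open>rad_decreasing_le_power\<close>).

  The class contains functions with negative values, and for these \<open>\<bar>f\<bar>\<close> is not decreasing. But
  once \<open>f\<close> is negative, \<open>\<bar>f\<bar>\<close> stays away from 0 on arbitrarily large cubes, so that \<open>N = \<infinity>\<close> and there
  is nothing to prove (\<open>rad_decreasing_nonneg\<close>).

  The power \<open>\<bar>x\<bar>\<^sup>-\<^sup>\<lambda>\<close> is stable under both operations in the claim. Its maximal function is at most a
  multiple of itself (\<open>maximal_power_bound\<close>), and it belongs to the Zygmund-Morrey space, since
  \<open>t(1 + log\<^sup>+ t)\<close> is at most \<open>1 + A t\<^sup>p\<close> and \<open>p > 1\<close> can be chosen with \<open>\<lambda>p < n\<close>
  (\<open>zygmund_morrey_power_bound\<close>). Both facts rest on one estimate: for \<open>0 < m < n\<close> the average of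
  \<open>\<bar>y\<bar>\<^sup>-\<^sup>m\<close> over a cube of side \<open>s\<close>, wherever the cube lies, is at most a constant times \<open>s\<^sup>-\<^sup>m\<close>
  (\<open>average_norm_powr_cube_le\<close>). Chaining the three bounds gives a multiple of \<open>N\<close>.
\<close>

section \<open>Cubes and averages\<close>

lemma emeasure_cube:
  fixes a :: "'a::euclidean_space"
  assumes "0 < s"
  shows "emeasure lborel (cbox a (a + s *\<^sub>R One)) = ennreal (s ^ DIM('a))"
  using assms by (simp add: emeasure_lborel_cbox_eq inner_simps)

lemma measure_cube_powr:
  fixes a :: "'a::euclidean_space"
  assumes "0 < s"
  shows "measure lebesgue (cbox a (a + s *\<^sub>R One)) powr (l / real DIM('a)) = s powr l"
  using assms by (simp add: measure_def emeasure_cube powr_realpow[symmetric] powr_powr)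

lemma AE_lebesgue_neq: "AE x in lebesgue. x \<noteq> (c::'a::euclidean_space)"
  by (intro AE_completion AE_lborel_singleton)

lemma average_mono_AE:
  assumes "AE x in lebesgue. x \<in> Q \<longrightarrow> h x \<le> k x"
  shows "average Q h \<le> average Q k"
  unfolding average_def
proof (intro divide_right_mono_ennreal nn_integral_mono_AE)
  show "AE x in lebesgue. h x * indicator Q x \<le> k x * indicator Q x"
    using assms by eventually_elim (auto simp: indicator_def)
qed

lemma average_const:
  assumes "Q \<in> cubes"
  shows "average Q (\<lambda>_. c) = c"
proof -
  obtain a s where Q: "Q = cbox a (a + s *\<^sub>R One)" "0 < s"
    using assms by (auto simp: cubes_def)
  have "average Q (\<lambda>_. c) = c * emeasure lebesgue Q / emeasure lebesgue Q"
    unfolding average_def Q by (subst nn_integral_cmult_indicator) auto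
  also have "\<dots> = c"
    using Q by (intro mult_divide_eq_ennreal) (auto simp: emeasure_cube)
  finally show ?thesis .
qed

section \<open>Averages of negative powers of the norm\<close>

lemma dyadic_scale:
  fixes s t :: real
  assumes "0 < t" "t < s"
  obtains k :: nat where "s / 2 ^ Suc k < t" "t \<le> s / 2 ^ k"
proof -
  have "\<exists>k::nat. s / 2 ^ Suc k < t"
  proof -
    obtain k where "(1/2) ^ k < t / s"
      using real_arch_pow_inv[of "t / s" "1/2"] assms by auto
    then have "s / 2 ^ k < t"
      using assms by (simp add: field_simps power_one_over)
    moreover have "s / 2 ^ Suc k \<le> s / 2 ^ k"
      using assms by (simp add: field_simps)
    ultimately show ?thesis by (intro exI[of _ k]) linarith
  qed
  then obtain k where k: "s / 2 ^ Suc k < t" and least: "\<And>j. j < k \<Longrightarrow> \<not> s / 2 ^ Suc j < t"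
    using exists_least_iff[of "\<lambda>k. s / 2 ^ Suc k < t"] by blast
  have "t \<le> s / 2 ^ k"
    using least[of "k - 1"] assms by (cases k) auto
  with k show ?thesis by (rule that)
qed

lemma borel_measurable_norm_powr:
  "(\<lambda>y::'a::euclidean_space. ennreal (norm y powr p)) \<in> borel_measurable lebesgue"
  by (rule measurable_completion) measurable

text \<open>
  Outside the ball of radius \<open>s\<close> about the origin the integrand is at most \<open>s\<^sup>-\<^sup>m\<close>. Inside it, the
  dyadic shell \<open>s/2\<^sup>k\<^sup>+\<^sup>1 < \<bar>y\<bar> \<le> s/2\<^sup>k\<close> contributes at most a constant times \<open>s\<^sup>n\<^sup>-\<^sup>m q\<^sup>k\<close> with
  \<open>q = 2\<^sup>m\<^sup>-\<^sup>n\<close>, and \<open>m < n\<close> makes this a convergent geometric series. Division by \<open>\<bar>Q\<bar> = s\<^sup>n\<close> gives the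
  bound. The constant is the same for all positions of the cube.
\<close>

lemma average_norm_powr_cube_le:
  assumes "0 < m" "m < real DIM('a)"
  obtains K where "0 < K"
    "\<And>(a::'a::euclidean_space) s. 0 < s \<Longrightarrow>
      average (cbox a (a + s *\<^sub>R One)) (\<lambda>y. ennreal (norm y powr - m)) \<le> ennreal (K * s powr - m)"
proof -
  define n where "n = real DIM('a)"
  define V where "V = unit_ball_vol n"
  define q where "q = 2 powr (m - n)"
  define K where "K = 1 + V * 2 powr m * (1 / (1 - q))"
  have V: "0 < V" by (simp add: V_def n_def)
  have q: "0 < q" "q < 1" using assms powr_less_mono[of "m - n" 0 2] by (simp_all add: q_def n_def)
  have K: "0 < K" unfolding K_def using V q by (intro add_pos_nonneg) auto
  show ?thesis
  proof (rule that[OF K])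
    fix a :: 'a and s :: real
    assume s: "0 < s"
    define Q where "Q = cbox a (a + s *\<^sub>R One)"
    define r where "r = (\<lambda>k::nat. s / 2 ^ k)"
    have r: "0 < r k" for k using s by (simp add: r_def)
    define S where "S = (\<lambda>y::'a. \<Sum>k. ennreal (r (Suc k) powr - m) * indicator (cball 0 (r k)) y)"
    \<comment> \<open>Each shell is enlarged to the ball that contains it; this costs only a constant factor. At
      \<open>y = 0\<close> the left side is 0, because \<open>0 powr - m = 0\<close>.\<close>
    have pointwise: "ennreal (norm y powr - m) * indicator Q y
        \<le> ennreal (s powr - m) * indicator Q y + S y" for y :: 'a
    proof (cases "0 < norm y \<and> norm y < s")
      case True
      then obtain k where k: "s / 2 ^ Suc k < norm y" "norm y \<le> s / 2 ^ k"
        using dyadic_scale by metis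
      have "ennreal (norm y powr - m) * indicator Q y \<le> ennreal (r (Suc k) powr - m) * indicator (cball 0 (r k)) y"
        using k r[of "Suc k"] assms by (auto simp: indicator_def r_def intro!: powr_mono2')
      also have "\<dots> \<le> S y"
        unfolding S_def
      proof -
        have "sum f {k} \<le> suminf f" for f :: "nat \<Rightarrow> ennreal"
          by (intro sum_le_suminf summableI) auto
        then show "ennreal (r (Suc k) powr - m) * indicator (cball 0 (r k)) y
            \<le> (\<Sum>k. ennreal (r (Suc k) powr - m) * indicator (cball 0 (r k)) y)"
          by (metis (no_types, lifting) finite.emptyI sum.empty sum.insert empty_iff add.right_neutral)
      qed
      finally show ?thesis by (simp add: add_increasing)
    next
      case False
      then have "norm y powr - m \<le> s powr - m"
        using s assms by (cases "y = 0") (auto intro!: powr_mono2')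
      then show ?thesis
        by (intro add_increasing2 mult_right_mono ennreal_leI) auto
    qed
    have term_eq: "r (Suc k) powr - m * (V * r k ^ DIM('a)) = V * 2 powr m * s powr (n - m) * q ^ k" for k
    proof -
      have "r k ^ DIM('a) = r k powr n"
        using r[of k] by (simp add: n_def powr_realpow)
      moreover have "r (Suc k) powr - m = (r k / 2) powr - m" by (simp add: r_def mult.commute)
      moreover have "(r k / 2) powr - m = r k powr - m * 2 powr m"
        using r[of k] by (simp add: powr_divide powr_minus field_simps)
      ultimately have "r (Suc k) powr - m * (V * r k ^ DIM('a)) = V * 2 powr m * (r k powr - m * r k powr n)"
        by simp
      also have "r k powr - m * r k powr n = s powr (n - m) * q ^ k"
      proof -
        have "r k powr - m * r k powr n = r k powr (n - m)"
          by (simp add: powr_add[symmetric])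
        also have "\<dots> = s powr (n - m) / (2 ^ k) powr (n - m)"
          using s by (simp add: r_def powr_divide)
        also have "(2 ^ k) powr (n - m) = (2 powr (n - m)) ^ k"
          by (simp add: powr_realpow[symmetric] powr_powr powr_power mult.commute)
        also have "s powr (n - m) / (2 powr (n - m)) ^ k = s powr (n - m) * q ^ k"
          using powr_minus[of 2 "n - m"] by (simp add: q_def divide_inverse power_inverse)
        finally show ?thesis .
      qed
      finally show ?thesis by (simp add: mult.assoc)
    qed
    have sums: "(\<lambda>k. V * 2 powr m * s powr (n - m) * q ^ k) sums
        (V * 2 powr m * s powr (n - m) * (1 / (1 - q)))"
      using q by (intro sums_mult geometric_sums) auto
    have meas: "(\<lambda>y::'a. ennreal (r (Suc k) powr - m) * indicator (cball 0 (r k)) y) \<in> borel_measurable lborel" for k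
      by (intro borel_measurable_times_ennreal borel_measurable_const borel_measurable_indicator) simp
    have int_S: "(\<integral>\<^sup>+y. S y \<partial>lborel) = ennreal (V * 2 powr m * s powr (n - m) * (1 / (1 - q)))"
    proof -
      have "(\<integral>\<^sup>+y. S y \<partial>lborel)
          = (\<Sum>k. \<integral>\<^sup>+y. ennreal (r (Suc k) powr - m) * indicator (cball 0 (r k)) (y::'a) \<partial>lborel)"
        unfolding S_def using meas by (rule nn_integral_suminf)
      also have "\<dots> = (\<Sum>k. ennreal (r (Suc k) powr - m) * ennreal (V * r k ^ DIM('a)))"
      proof (rule suminf_cong)
        fix k
        show "(\<integral>\<^sup>+y. ennreal (r (Suc k) powr - m) * indicator (cball 0 (r k)) (y::'a) \<partial>lborel)
            = ennreal (r (Suc k) powr - m) * ennreal (V * r k ^ DIM('a))"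
          using r[of k] by (simp add: nn_integral_cmult_indicator emeasure_cball V_def n_def)
      qed
      also have "\<dots> = (\<Sum>k. ennreal (V * 2 powr m * s powr (n - m) * q ^ k))"
        by (simp only: term_eq[symmetric] ennreal_mult' powr_ge_zero)
      also have "\<dots> = ennreal (V * 2 powr m * s powr (n - m) * (1 / (1 - q)))"
        using V q by (intro suminf_ennreal_eq sums mult_nonneg_nonneg) auto
      finally show ?thesis .
    qed
    have Q: "emeasure lborel Q = ennreal (s ^ DIM('a))" "Q \<in> sets borel"
      using emeasure_cube[OF s, of a] by (auto simp: Q_def)
    have sn: "s ^ DIM('a) = s powr n" using s by (simp add: n_def powr_realpow)
    have "(\<integral>\<^sup>+y\<in>Q. ennreal (norm y powr - m) \<partial>lebesgue)
        \<le> (\<integral>\<^sup>+y. ennreal (s powr - m) * indicator Q y + S y \<partial>lborel)"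
      unfolding nn_integral_completion by (intro nn_integral_mono pointwise)
    also have "\<dots> = (\<integral>\<^sup>+y. ennreal (s powr - m) * indicator Q y \<partial>lborel) + (\<integral>\<^sup>+y. S y \<partial>lborel)"
    proof (rule nn_integral_add)
      show "(\<lambda>y. ennreal (s powr - m) * indicator Q y) \<in> borel_measurable lborel"
        using Q(2) by (intro borel_measurable_times_ennreal borel_measurable_const borel_measurable_indicator) simp
      show "S \<in> borel_measurable lborel"
        unfolding S_def using meas by (rule borel_measurable_suminf_order)
    qed
    also have "\<dots> = ennreal (s powr - m) * ennreal (s powr n)
        + ennreal (V * 2 powr m * s powr (n - m) * (1 / (1 - q)))"
      using Q by (simp add: nn_integral_cmult_indicator int_S sn)
    also have "\<dots> = ennreal (s powr - m * s powr n + V * 2 powr m * s powr (n - m) * (1 / (1 - q)))"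
      using V q by (simp add: ennreal_mult[symmetric] ennreal_plus[symmetric] del: ennreal_plus)
    also have "s powr - m * s powr n + V * 2 powr m * s powr (n - m) * (1 / (1 - q)) = K * s powr - m * s powr n"
    proof -
      have "s powr - m * s powr n = s powr (n - m)" by (simp add: powr_add[symmetric])
      then show ?thesis by (simp add: K_def mult.assoc distrib_right)
    qed
    finally have "(\<integral>\<^sup>+y\<in>Q. ennreal (norm y powr - m) \<partial>lebesgue) \<le> ennreal (K * s powr - m * s powr n)" .
    then have "average Q (\<lambda>y. ennreal (norm y powr - m)) \<le> ennreal (K * s powr - m * s powr n) / ennreal (s powr n)"
      unfolding average_def using Q by (auto simp: sn intro!: divide_right_mono_ennreal)
    also have "\<dots> = ennreal (K * s powr - m)"
      using K s by (subst divide_ennreal) auto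
    finally show "average (cbox a (a + s *\<^sub>R One)) (\<lambda>y. ennreal (norm y powr - m)) \<le> ennreal (K * s powr - m)"
      by (simp add: Q_def)
  qed
qed

section \<open>The maximal function of a negative power\<close>

lemma average_affine:
  assumes "Q \<in> cubes" and [measurable]: "h \<in> borel_measurable lebesgue"
  shows "average Q (\<lambda>x. c + d * h x) = c + d * average Q h"
proof -
  obtain a s where Q: "Q = cbox a (a + s *\<^sub>R One)" "0 < s"
    using assms by (auto simp: cubes_def)
  have [measurable]: "Q \<in> sets lebesgue" by (simp add: Q)
  have "(\<integral>\<^sup>+x\<in>Q. (c + d * h x) \<partial>lebesgue)
      = (\<integral>\<^sup>+x. c * indicator Q x + d * (h x * indicator Q x) \<partial>lebesgue)"
    by (intro nn_integral_cong) (simp add: algebra_simps)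
  also have "\<dots> = (\<integral>\<^sup>+x\<in>Q. c \<partial>lebesgue) + d * (\<integral>\<^sup>+x\<in>Q. h x \<partial>lebesgue)"
    by (subst nn_integral_add) (auto simp: nn_integral_cmult)
  finally have "average Q (\<lambda>x. c + d * h x) = average Q (\<lambda>_. c) + d * average Q h"
    by (simp add: average_def add_divide_distrib_ennreal ennreal_times_divide)
  then show ?thesis using assms by (simp add: average_const)
qed

lemma norm_diff_cube_le:
  fixes x y a :: "'a::euclidean_space"
  assumes "x \<in> cbox a (a + s *\<^sub>R One)" "y \<in> cbox a (a + s *\<^sub>R One)"
  shows "norm (y - x) \<le> real DIM('a) * s"
proof -
  have "norm (y - x) \<le> (\<Sum>b\<in>Basis. \<bar>(y - x) \<bullet> b\<bar>)" by (rule norm_le_l1)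
  also have "\<dots> \<le> (\<Sum>b\<in>(Basis::'a set). s)"
    using assms by (intro sum_mono) (force simp: mem_box inner_simps)
  finally show ?thesis by simp
qed

lemma abs_val_enn2ereal [simp]: "abs_val (enn2ereal z) = z"
  by (simp add: abs_val_def)

text \<open>
  A cube through \<open>x\<close> is either large, with side at least \<open>\<bar>x\<bar>/(2n)\<close>, and then the average bound
  \<open>s\<^sup>-\<^sup>l\<close> is already of size \<open>\<bar>x\<bar>\<^sup>-\<^sup>l\<close>; or it is so small that it stays outside the ball of radius
  \<open>\<bar>x\<bar>/2\<close>, where the power itself is of this size. An almost everywhere bound is assumed, because
  values at the origin are unrestricted.
\<close>

lemma maximal_power_bound:
  assumes "0 < l" "l < real DIM('a)"
  obtains K where "0 < K"
    "\<And>(g :: 'a::euclidean_space \<Rightarrow> ereal) B x. 0 \<le> B \<Longrightarrow> x \<noteq> 0 \<Longrightarrow>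
      AE y in lebesgue. abs_val (g y) \<le> ennreal (B * norm y powr - l) \<Longrightarrow>
      abs_val (hl_maximal g x) \<le> ennreal (K * B * norm x powr - l)"
proof -
  obtain K0 where K0: "0 < K0" and avg: "\<And>(a::'a) s. 0 < s \<Longrightarrow>
      average (cbox a (a + s *\<^sub>R One)) (\<lambda>y. ennreal (norm y powr - l)) \<le> ennreal (K0 * s powr - l)"
    using average_norm_powr_cube_le[OF assms] by metis
  define n where "n = real DIM('a)"
  have n: "0 < n" by (simp add: n_def)
  define K where "K = 2 powr l + K0 * (2 * n) powr l"
  have K: "0 < K" using K0 n by (simp add: K_def add_pos_nonneg)
  show ?thesis
  proof (rule that[OF K])
    fix g :: "'a \<Rightarrow> ereal" and B :: real and x :: 'a
    assume B: "0 \<le> B" and x: "x \<noteq> 0"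
      and g: "AE y in lebesgue. abs_val (g y) \<le> ennreal (B * norm y powr - l)"
    have "average Q (\<lambda>y. abs_val (g y)) \<le> ennreal (K * B * norm x powr - l)"
      if Q: "Q \<in> cubes" "x \<in> Q" for Q
    proof -
      obtain a s where as: "Q = cbox a (a + s *\<^sub>R One)" and s: "0 < s"
        using Q by (auto simp: cubes_def)
      have "average Q (\<lambda>y. abs_val (g y)) \<le> average Q (\<lambda>y. ennreal (B * norm y powr - l))"
        using g by (intro average_mono_AE) auto
      also have "\<dots> \<le> ennreal (K * B * norm x powr - l)"
      proof (cases "norm x / (2 * n) \<le> s")
        case True
        have "average Q (\<lambda>y. ennreal (B * norm y powr - l)) = ennreal B * average Q (\<lambda>y. ennreal (norm y powr - l))"
          using average_affine[OF Q(1), of "\<lambda>y. ennreal (norm y powr - l)" 0 "ennreal B"] B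
          by (simp add: ennreal_mult borel_measurable_norm_powr)
        also have "\<dots> \<le> ennreal B * ennreal (K0 * s powr - l)"
          unfolding as using s by (intro mult_left_mono avg) auto
        also have "\<dots> = ennreal (B * (K0 * s powr - l))"
          using B K0 by (simp add: ennreal_mult)
        also have "\<dots> \<le> ennreal (B * (K0 * ((norm x / (2 * n)) powr - l)))"
          using True x n assms K0 B
          by (intro ennreal_leI mult_left_mono powr_mono2') auto
        also have "\<dots> = ennreal (K0 * (2 * n) powr l * B * norm x powr - l)"
          using x n by (simp add: powr_divide powr_minus field_simps)
        also have "\<dots> \<le> ennreal (K * B * norm x powr - l)"
          using B by (intro ennreal_leI mult_right_mono) (auto simp: K_def)
        finally show ?thesis .
      next
        case False
        have "norm x / 2 \<le> norm y" if "y \<in> Q" for y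
        proof -
          have "norm (y - x) \<le> n * s"
            using norm_diff_cube_le[of x a s y] that Q by (simp add: as n_def)
          also have "n * s \<le> norm x / 2"
            using False n by (simp add: field_simps)
          finally show ?thesis
            using norm_triangle_ineq2[of x y] by (simp add: norm_minus_commute)
        qed
        then have "average Q (\<lambda>y. ennreal (B * norm y powr - l)) \<le> average Q (\<lambda>_. ennreal (B * (norm x / 2) powr - l))"
          using x assms B
          by (intro average_mono_AE AE_I2 impI ennreal_leI mult_left_mono powr_mono2') auto
        also have "\<dots> = ennreal (2 powr l * B * norm x powr - l)"
          using x Q by (simp add: average_const powr_divide powr_minus field_simps)
        also have "\<dots> \<le> ennreal (K * B * norm x powr - l)"
          using B K0 by (intro ennreal_leI mult_right_mono) (auto simp: K_def)
        finally show ?thesis .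
      qed
      finally show ?thesis .
    qed
    then show "abs_val (hl_maximal g x) \<le> ennreal (K * B * norm x powr - l)"
      by (auto simp: hl_maximal_def intro!: SUP_least)
  qed
qed

section \<open>The Zygmund-Morrey norm of a negative power\<close>

lemma log_plus_ennreal: "0 \<le> u \<Longrightarrow> log_plus (ennreal u) = ennreal (max (ln u) 0)"
  by (simp add: log_plus_def)

lemma log_plus_mono:
  assumes "s \<le> t"
  shows "log_plus s \<le> log_plus t"
proof (cases s; cases t)
  fix u v assume st: "0 \<le> u" "s = ennreal u" "0 \<le> v" "t = ennreal v"
  then have "u \<le> v" using assms by simp
  then have "max (ln u) 0 \<le> max (ln v) 0"
    using st by (cases "u = 0") (auto simp: max.coboundedI1)
  then show ?thesis using st by (simp add: log_plus_ennreal ennreal_leI del: max.bounded_iff)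
qed (use assms in \<open>auto simp: log_plus_def top_unique\<close>)

text \<open>
  The logarithm costs less than any power: \<open>ln u \<le> u\<^sup>p\<^sup>-\<^sup>1/(p - 1)\<close> for \<open>u \<ge> 1\<close>. Division of \<open>u\<close> by
  \<open>D \<ge> 1\<close> lowers the logarithm and leaves a factor \<open>1/D\<close>, which is the room needed to bring an
  average below 1 in a Luxemburg norm.
\<close>

lemma young_function_le_power:
  fixes u D p :: real
  assumes "0 \<le> u" "1 \<le> D" "1 < p"
  shows "u / D * (1 + max (ln (u / D)) 0) \<le> (1 + (1 + 1 / (p - 1)) * u powr p) / D"
proof -
  have "max (ln (u / D)) 0 \<le> max (ln u) 0"
    using assms by (cases "u = 0") (auto simp: ln_div max.coboundedI1)
  then have "u * (1 + max (ln (u / D)) 0) \<le> u * (1 + max (ln u) 0)"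
    using assms by (intro mult_left_mono) auto
  also have "\<dots> \<le> 1 + (1 + 1 / (p - 1)) * u powr p"
  proof (cases "u \<le> 1")
    case True
    then have "max (ln u) 0 = 0" using assms(1) by (cases "u = 0") (auto simp: max_def)
    then show ?thesis using True assms by (simp add: add_increasing2)
  next
    case False
    have "u * ln u \<le> u * (u powr (p - 1) / (p - 1))"
      using False assms by (intro mult_left_mono ln_powr_bound) auto
    also have "\<dots> = u powr p / (p - 1)"
      using False by (simp add: powr_diff)
    finally have "u * ln u \<le> u powr p / (p - 1)" .
    moreover have "u \<le> u powr p"
      using False assms powr_mono[of 1 p u] by simp
    ultimately show ?thesis using False by (simp add: max_def algebra_simps)
  qed
  finally show ?thesis using assms by (simp add: divide_right_mono)
qed

text \<open>
  On a cube of side \<open>s\<close> the number \<open>\<alpha> = D B s\<^sup>-\<^sup>l\<close> is admissible in the Luxemburg norm: after division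
  by \<open>\<alpha>\<close> the function is at most \<open>u/D\<close> with \<open>u = (\<bar>x\<bar>/s)\<^sup>-\<^sup>l\<close>, whose \<open>p\<close>-th power has a bounded average
  because \<open>lp < n\<close>. The factor \<open>s\<^sup>l\<close> in the Morrey norm then cancels the dependence on \<open>s\<close>.
\<close>

lemma zygmund_morrey_power_bound:
  assumes "0 < l" "l < real DIM('a)"
  obtains D where "0 < D"
    "\<And>(g :: 'a::euclidean_space \<Rightarrow> ereal) B. 0 < B \<Longrightarrow>
      AE x in lebesgue. abs_val (g x) \<le> ennreal (B * norm x powr - l) \<Longrightarrow>
      zygmund_morrey_norm l g \<le> ennreal (D * B)"
proof -
  \<comment> \<open>Any exponent strictly between \<open>l\<close> and the dimension works; the exponent \<open>p\<close> is then \<open>m / l > 1\<close>.\<close>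
  define m where "m = (l + real DIM('a)) / 2"
  have m: "0 < m" "m < real DIM('a)" "l < m" using assms by (auto simp: m_def)
  obtain K where K: "0 < K" and avg: "\<And>(a::'a) s. 0 < s \<Longrightarrow>
      average (cbox a (a + s *\<^sub>R One)) (\<lambda>y. ennreal (norm y powr - m)) \<le> ennreal (K * s powr - m)"
    using average_norm_powr_cube_le[OF m(1,2)] by metis
  define p where "p = m / l"
  have p: "1 < p" "l * p = m" using m assms by (auto simp: p_def)
  define A where "A = 1 + 1 / (p - 1)"
  have A: "0 < A" using p by (simp add: A_def add_pos_pos)
  \<comment> \<open>\<open>1 + A K\<close> bounds the average of \<open>1 + A u powr p\<close>, so this \<open>D\<close> makes the Luxemburg average at most 1.\<close>
  define D where "D = 1 + A * K"
  have D: "1 \<le> D" using A K by (simp add: D_def)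
  then have D0: "0 < D" by simp
  show ?thesis
  proof (rule that[OF D0])
    fix g :: "'a \<Rightarrow> ereal" and B :: real
    assume B: "0 < B" and g: "AE x in lebesgue. abs_val (g x) \<le> ennreal (B * norm x powr - l)"
    show "zygmund_morrey_norm l g \<le> ennreal (D * B)"
      unfolding zygmund_morrey_norm_def
    proof (rule SUP_least)
      fix Q :: "'a set" assume Q: "Q \<in> cubes"
      then obtain a s where as: "Q = cbox a (a + s *\<^sub>R One)" and s: "0 < s"
        by (auto simp: cubes_def)
      define \<alpha> where "\<alpha> = D * B * s powr - l"
      have \<alpha>: "0 < \<alpha>" using D0 B s by (simp add: \<alpha>_def)
      have point: "abs_val (g x) / ennreal \<alpha> * (1 + log_plus (abs_val (g x) / ennreal \<alpha>))
          \<le> ennreal (1 / D) + ennreal (A * s powr m / D) * ennreal (norm x powr - m)"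
        if gx: "abs_val (g x) \<le> ennreal (B * norm x powr - l)" for x
      proof -
        define u where "u = norm x powr - l * s powr l"
        have u: "0 \<le> u" by (simp add: u_def)
        have "abs_val (g x) / ennreal \<alpha> \<le> ennreal (B * norm x powr - l) / ennreal \<alpha>"
          using gx by (rule divide_right_mono_ennreal)
        also have "\<dots> = ennreal (u / D)"
          using B \<alpha> D0 s by (simp add: divide_ennreal u_def \<alpha>_def powr_minus field_simps)
        finally have le: "abs_val (g x) / ennreal \<alpha> \<le> ennreal (u / D)" .
        have "abs_val (g x) / ennreal \<alpha> * (1 + log_plus (abs_val (g x) / ennreal \<alpha>))
            \<le> ennreal (u / D) * (1 + log_plus (ennreal (u / D)))"
          by (intro mult_mono add_mono order_refl log_plus_mono le) auto
        also have "\<dots> = ennreal (u / D * (1 + max (ln (u / D)) 0))"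
        proof -
          have "1 + ennreal (max (ln (u / D)) 0) = ennreal (1 + max (ln (u / D)) 0)"
            by (subst ennreal_plus) auto
          then show ?thesis
            using u D0 by (subst log_plus_ennreal) (simp_all only: ennreal_mult' divide_nonneg_pos)
        qed
        also have "\<dots> \<le> ennreal ((1 + A * u powr p) / D)"
          unfolding A_def using u D p by (intro ennreal_leI young_function_le_power)
        also have "u powr p = s powr m * norm x powr - m"
          by (simp add: u_def powr_mult powr_powr p(2)[symmetric])
        also have "(1 + A * (s powr m * norm x powr - m)) / D = 1 / D + A * s powr m / D * norm x powr - m"
          by (simp add: add_divide_distrib)
        also have "ennreal \<dots> = ennreal (1 / D) + ennreal (A * s powr m / D) * ennreal (norm x powr - m)"
          using D0 A by (simp add: ennreal_mult'[symmetric])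
        finally show ?thesis .
      qed
      have "average Q (\<lambda>x. abs_val (g x) / ennreal \<alpha> * (1 + log_plus (abs_val (g x) / ennreal \<alpha>)))
          \<le> average Q (\<lambda>x. ennreal (1 / D) + ennreal (A * s powr m / D) * ennreal (norm x powr - m))"
        by (intro average_mono_AE eventually_mono[OF g] impI point)
      also have "\<dots> = ennreal (1 / D) + ennreal (A * s powr m / D) * average Q (\<lambda>x. ennreal (norm x powr - m))"
        using Q by (intro average_affine borel_measurable_norm_powr)
      also have "\<dots> \<le> ennreal (1 / D) + ennreal (A * s powr m / D) * ennreal (K * s powr - m)"
        unfolding as using s by (intro add_left_mono mult_left_mono avg) auto
      also have "\<dots> = ennreal (1 / D + A * s powr m / D * (K * s powr - m))"
        using D0 A K by (simp add: ennreal_mult'[symmetric] ennreal_plus[symmetric] del: ennreal_plus)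
      also have "1 / D + A * s powr m / D * (K * s powr - m) = 1"
        using s D0 by (simp add: powr_minus field_simps D_def)
      finally have "zygmund_norm Q g \<le> ennreal \<alpha>"
        unfolding zygmund_norm_def using \<alpha> by (intro INF_lower) auto
      then have "ennreal (measure lebesgue Q powr (l / real DIM('a))) * zygmund_norm Q g
          \<le> ennreal (s powr l) * ennreal \<alpha>"
        unfolding as measure_cube_powr[OF s] by (intro mult_left_mono) auto
      also have "\<dots> = ennreal (D * B)"
      proof -
        have "s powr l * s powr - l = 1" using s by (simp add: powr_add[symmetric])
        then have "s powr l * \<alpha> = D * B"
          by (simp add: \<alpha>_def mult.left_commute[of "s powr l"])
        then show ?thesis using \<alpha> by (simp add: ennreal_mult[symmetric])
      qed
      finally show "ennreal (measure lebesgue Q powr (l / real DIM('a))) * zygmund_norm Q g \<le> ennreal (D * B)" .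
    qed
  qed
qed

section \<open>Radially decreasing functions lie below a negative power\<close>

text \<open>
  The Young function \<open>t(1 + log\<^sup>+ t)\<close> is at least \<open>t\<close>, so the Luxemburg norm on a cube is at least any
  constant that \<open>\<bar>f\<bar>\<close> dominates there.
\<close>

lemma zygmund_morrey_norm_ge:
  fixes f :: "'a::euclidean_space \<Rightarrow> ereal" and a :: 'a
  assumes s: "0 < s"
    and le: "AE y in lebesgue. y \<in> cbox a (a + s *\<^sub>R One) \<longrightarrow> c \<le> abs_val (f y)"
  shows "ennreal (s powr l) * c \<le> zygmund_morrey_norm l f"
proof -
  define Q where "Q = cbox a (a + s *\<^sub>R One)"
  have Q: "Q \<in> cubes" using s by (auto simp: cubes_def Q_def)
  have "c \<le> zygmund_norm Q f"
    unfolding zygmund_norm_def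
  proof (rule INF_greatest, clarify)
    fix \<alpha> :: real
    assume \<alpha>: "0 < \<alpha>"
      and adm: "average Q (\<lambda>x. abs_val (f x) / ennreal \<alpha> * (1 + log_plus (abs_val (f x) / ennreal \<alpha>))) \<le> 1"
    have "c / ennreal \<alpha> = average Q (\<lambda>_. c / ennreal \<alpha>)"
      using Q by (simp add: average_const)
    also have "\<dots> \<le> average Q (\<lambda>x. abs_val (f x) / ennreal \<alpha> * (1 + log_plus (abs_val (f x) / ennreal \<alpha>)))"
    proof (intro average_mono_AE)
      show "AE x in lebesgue. x \<in> Q \<longrightarrow>
          c / ennreal \<alpha> \<le> abs_val (f x) / ennreal \<alpha> * (1 + log_plus (abs_val (f x) / ennreal \<alpha>))"
        using le
      proof eventually_elim
        case (elim x)
        show ?case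
        proof
          assume "x \<in> Q"
          then have "c / ennreal \<alpha> * 1 \<le> abs_val (f x) / ennreal \<alpha> * (1 + log_plus (abs_val (f x) / ennreal \<alpha>))"
            using elim by (intro mult_mono divide_right_mono_ennreal) (auto simp: Q_def)
          then show "c / ennreal \<alpha> \<le> abs_val (f x) / ennreal \<alpha> * (1 + log_plus (abs_val (f x) / ennreal \<alpha>))"
            by simp
        qed
      qed
    qed
    also note adm
    finally have "c / ennreal \<alpha> * ennreal \<alpha> \<le> 1 * ennreal \<alpha>"
      by (rule mult_right_mono) simp
    then show "c \<le> ennreal \<alpha>"
      using \<alpha> by (simp add: ennreal_divide_times)
  qed
  then have "ennreal (s powr l) * c \<le> ennreal (measure lebesgue Q powr (l / real DIM('a))) * zygmund_norm Q f"
    unfolding Q_def measure_cube_powr[OF s] by (rule mult_left_mono) simp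
  also have "\<dots> \<le> zygmund_morrey_norm l f"
    unfolding zygmund_morrey_norm_def using Q by (rule SUP_upper)
  finally show ?thesis .
qed

lemma rad_decreasing_antimono:
  assumes "f \<in> rad_decreasing" "x \<noteq> 0" "norm x \<le> norm y"
  shows "f y \<le> f x"
proof -
  obtain \<phi> where \<phi>: "antimono_on {0<..} \<phi>" "\<And>x. f x = \<phi> (norm x)"
    using assms by (auto simp: rad_decreasing_def)
  have "0 < norm x" using assms by simp
  moreover have "0 < norm y" using assms calculation by linarith
  ultimately show ?thesis
    using monotone_onD[OF \<phi>(1), of "norm x" "norm y"] assms by (simp add: \<phi>(2))
qed

text \<open>
  If \<open>f(x) < 0\<close>, then \<open>\<bar>f\<bar> \<ge> \<bar>f(x)\<bar> > 0\<close> outside the ball of radius \<open>\<bar>x\<bar>\<close>, which contains cubes of every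
  side length \<open>s\<close>. On these the Morrey factor \<open>s\<^sup>l\<close> is unbounded.
\<close>

lemma rad_decreasing_nonneg:
  fixes f :: "'a::euclidean_space \<Rightarrow> ereal"
  assumes f: "f \<in> rad_decreasing" and l: "0 < l"
    and fin: "zygmund_morrey_norm l f < \<infinity>" and x: "x \<noteq> 0"
  shows "0 \<le> f x"
proof (rule ccontr)
  assume neg: "\<not> 0 \<le> f x"
  define c where "c = abs_val (f x)"
  have c: "0 < c"
    using neg by (cases "f x") (auto simp: c_def abs_val_def e2ennreal_ereal zero_less_iff_neq_zero)
  \<comment> \<open>Every coordinate of a point of a cube with this lower corner is at least \<open>norm x\<close>.\<close>
  define a :: 'a where "a = norm x *\<^sub>R One"
  have ge: "c \<le> abs_val (f y)" if y: "y \<in> cbox a (a + s *\<^sub>R One)" for y s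
  proof -
    obtain b :: 'a where b: "b \<in> Basis" using nonempty_Basis by blast
    have "norm x \<le> y \<bullet> b" using y b by (auto simp: mem_box a_def)
    also have "\<dots> \<le> norm y" using Basis_le_norm[OF b, of y] by linarith
    finally have "f y \<le> f x" using f x by (intro rad_decreasing_antimono)
    then have "\<bar>f x\<bar> \<le> \<bar>f y\<bar>" using neg by (cases "f x"; cases "f y") auto
    then show ?thesis by (simp add: c_def abs_val_def e2ennreal_mono)
  qed
  obtain d where d: "0 < d" "ennreal d \<le> c"
    using c by (cases c) (auto intro: that[of 1])
  obtain N where N: "0 \<le> N" "zygmund_morrey_norm l f = ennreal N"
    using fin by (cases "zygmund_morrey_norm l f") auto
  define s where "s = ((N + 1) / d) powr (1 / l)"
  have "0 < s" using N d by (simp add: s_def)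
  then have "ennreal (s powr l) * c \<le> ennreal N"
    unfolding N(2)[symmetric] by (rule zygmund_morrey_norm_ge) (auto intro: ge)
  moreover have "ennreal (N + 1) = ennreal (s powr l) * ennreal d"
    using N d l by (simp add: s_def powr_powr ennreal_mult'[symmetric])
  moreover have "ennreal (s powr l) * ennreal d \<le> ennreal (s powr l) * c"
    using d by (intro mult_left_mono) auto
  ultimately have "ennreal (N + 1) \<le> ennreal N" by simp
  then show False using N by simp
qed

text \<open>
  The cube of side \<open>\<bar>x\<bar>/n\<close> with lower corner at the origin is contained in the closed ball of radius
  \<open>\<bar>x\<bar>\<close>, so \<open>f \<ge> f(x)\<close> almost everywhere on it; the origin has to be left out.
\<close>

lemma rad_decreasing_le_power:
  fixes f :: "'a::euclidean_space \<Rightarrow> ereal"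
  assumes f: "f \<in> rad_decreasing" and l: "0 < l"
    and N: "zygmund_morrey_norm l f \<le> ennreal B" and B: "0 \<le> B" and x: "x \<noteq> 0"
  shows "abs_val (f x) \<le> ennreal (real DIM('a) powr l * B * norm x powr - l)"
proof -
  define n where "n = real DIM('a)"
  have n: "0 < n" by (simp add: n_def)
  define s where "s = norm x / n"
  have s: "0 < s" using x n by (simp add: s_def)
  have nonneg: "0 \<le> f y" if "y \<noteq> 0" for y
    using f l that N by (intro rad_decreasing_nonneg) (auto simp: le_less_trans)
  have "abs_val (f x) \<le> abs_val (f y)" if y: "y \<in> cbox 0 (0 + s *\<^sub>R One)" "y \<noteq> 0" for y
  proof -
    have "norm (y - 0) \<le> n * s"
      unfolding n_def using y s by (intro norm_diff_cube_le[of _ 0]) (auto simp: mem_box)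
    then have "f x \<le> f y"
      using f y n by (intro rad_decreasing_antimono) (auto simp: s_def)
    then show ?thesis using nonneg x y by (auto simp: abs_val_def intro!: e2ennreal_mono)
  qed
  then have "ennreal (s powr l) * abs_val (f x) \<le> zygmund_morrey_norm l f"
    using AE_lebesgue_neq[of "0::'a"] s
    by (intro zygmund_morrey_norm_ge[where a = 0]) (auto elim!: eventually_mono)
  also note N
  finally have "ennreal (s powr - l) * (ennreal (s powr l) * abs_val (f x)) \<le> ennreal (s powr - l) * ennreal B"
    by (rule mult_left_mono) simp
  also have "ennreal (s powr - l) * (ennreal (s powr l) * abs_val (f x)) = abs_val (f x)"
    using s by (simp add: mult.assoc[symmetric] ennreal_mult[symmetric] powr_minus)
  also have "ennreal (s powr - l) * ennreal B = ennreal (n powr l * B * norm x powr - l)"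
    using B n x by (simp add: ennreal_mult[symmetric] s_def powr_divide powr_minus field_simps)
  finally show ?thesis by (simp add: n_def)
qed

section \<open>Boundedness of the maximal operator\<close>

theorem hl_maximal_bounded_on_rad_decreasing:
  assumes "0 < l" "l < real DIM('a)"
  shows "\<exists>c::real. 0 < c \<and> (\<forall>f :: 'a::euclidean_space \<Rightarrow> ereal. f \<in> rad_decreasing \<longrightarrow>
      zygmund_morrey_norm l (hl_maximal f) \<le> ennreal c * zygmund_morrey_norm l f)"
proof -
  obtain K where K: "0 < K" and max: "\<And>(g :: 'a \<Rightarrow> ereal) B x. 0 \<le> B \<Longrightarrow> x \<noteq> 0 \<Longrightarrow>
      AE y in lebesgue. abs_val (g y) \<le> ennreal (B * norm y powr - l) \<Longrightarrow>
      abs_val (hl_maximal g x) \<le> ennreal (K * B * norm x powr - l)"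
    by (rule maximal_power_bound[OF assms]) (blast intro: that)
  obtain D where D: "0 < D" and norm: "\<And>(g :: 'a \<Rightarrow> ereal) B. 0 < B \<Longrightarrow>
      AE x in lebesgue. abs_val (g x) \<le> ennreal (B * norm x powr - l) \<Longrightarrow>
      zygmund_morrey_norm l g \<le> ennreal (D * B)"
    by (rule zygmund_morrey_power_bound[OF assms]) (blast intro: that)
  define E where "E = real DIM('a) powr l"
  have E: "0 < E" by (simp add: E_def)
  define c where "c = D * (K * E)"
  have c: "0 < c" using D K E by (simp add: c_def)
  have "zygmund_morrey_norm l (hl_maximal f) \<le> ennreal c * zygmund_morrey_norm l f"
    if f: "f \<in> rad_decreasing" for f :: "'a \<Rightarrow> ereal"
  proof (cases "zygmund_morrey_norm l f")
    case top
    then show ?thesis using c by (simp add: ennreal_mult_top)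
  next
    case (real N)
    \<comment> \<open>The power bound needs a positive factor, so it is applied to every positive \<open>B \<ge> N\<close>, and
      \<open>B\<close> then tends to \<open>N\<close>. This covers \<open>N = 0\<close>.\<close>
    have bound: "zygmund_morrey_norm l (hl_maximal f) \<le> ennreal (c * B)" if B: "0 < B" "N \<le> B" for B
    proof -
      have "abs_val (f x) \<le> ennreal (E * B * norm x powr - l)" if "x \<noteq> 0" for x
        unfolding E_def using f assms B that real by (intro rad_decreasing_le_power) auto
      then have "AE x in lebesgue. abs_val (f x) \<le> ennreal (E * B * norm x powr - l)"
        using AE_lebesgue_neq[of "0::'a"] by (auto elim!: eventually_mono)
      then have "abs_val (hl_maximal f x) \<le> ennreal (K * (E * B) * norm x powr - l)" if "x \<noteq> 0" for x
        using that E B by (intro max) auto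
      then have "AE x in lebesgue. abs_val (hl_maximal f x) \<le> ennreal (K * (E * B) * norm x powr - l)"
        using AE_lebesgue_neq[of "0::'a"] by (auto elim!: eventually_mono)
      then have "zygmund_morrey_norm l (hl_maximal f) \<le> ennreal (D * (K * (E * B)))"
        using K E B by (intro norm) auto
      then show ?thesis by (simp add: c_def mult.assoc)
    qed
    have "zygmund_morrey_norm l (hl_maximal f) \<le> ennreal (c * N)"
    proof (rule ennreal_le_epsilon)
      fix e :: real assume e: "0 < e"
      have "zygmund_morrey_norm l (hl_maximal f) \<le> ennreal (c * (N + e / c))"
        using real e c by (intro bound) (auto simp: add_nonneg_pos)
      also have "c * (N + e / c) = c * N + e" using c by (simp add: field_simps)
      also have "ennreal (c * N + e) = ennreal (c * N) + ennreal e"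
        using real e c by (intro ennreal_plus) auto
      finally show "zygmund_morrey_norm l (hl_maximal f) \<le> ennreal (c * N) + ennreal e" .
    qed
    then show ?thesis using real c by (simp add: ennreal_mult)
  qed
  with c show ?thesis by blast
qed

theorem theorem5p5:
  fixes l :: real
  assumes "0 < l" and "l < real CARD('n::finite)"
  shows "\<exists>c::real. 0 < c \<and>
    (\<forall>f :: real ^ 'n \<Rightarrow> ereal. f \<in> rad_decreasing \<longrightarrow>
      zygmund_morrey_norm l (hl_maximal f) \<le> ennreal c * zygmund_morrey_norm l f)"
  using assms by (intro hl_maximal_bounded_on_rad_decreasing) auto

end
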